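(* Let $\mathcal{C}$ be a general boolean circuit with underlying boolean function $f$. Then the Tseitin translation $\mathrm{ts}(\mathcal{C})$ is a UP-representation of $f$. If $\mathcal{C}$ is in general NNF, then the reduced Tseitin translation $\mathrm{ts}_r(\mathcal{C})$ has usat-recognition via $r_1$ and sat-recognition via $r_{1}^{\mathrm{pl}}$ with respect to $\mathrm{var}(f)$.
   Context: Clauses are finite sets of literals without complementary pairs ($\bot$ empty clause), clause-sets finite sets of clauses read as CNF ($\top$ empty clause-set); $\varphi*F$ applies a partial assignment (delete satisfied clauses, delete falsified literals). $r_1$ is unit-clause propagation ($\{\bot\}$ if $\bot\in F$, otherwise repeatedly apply $\langle x\to 1\rangle$ for unit clauses $\{x\}$). $r_1^{\mathrm{pl}}$ first applies $r_1$ and then repeatedly sets all pure literals (literals $x$ with $\overline{x}$ not occurring) to $1$ until no change. For a boolean function $b$, $\mathrm{prc}_0(b)$ is its set of prime implicates (inclusion-minimal clauses implied by $b$). A general circuit is $\mathcal{C}=(G,I,b,o)$: $G$ a directed acyclic graph whose vertices are variables, $I$ a finite set of input variables disjoint from $V(G)$, $o\in V(G)$ the output node, and $b$ assigns to each vertex $v$ a boolean function $b_v$ with $\mathrm{in}(v)\subseteq\mathrm{var}(b_v)\subseteq\mathrm{in}(v)\cup I$ where $\mathrm{in}(v)$ is the set of vertices with an arc to $v$. The underlying boolean function $f$ of $\mathcal{C}$ is the function computed at $o$ (evaluating from the sources), with $\mathrm{var}(f)$ the set of essential input variables. $\mathrm{ts}(\mathcal{C})=\{\{o\}\}\cup\bigcup_{v\in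 V(G)}\mathrm{prc}_0(v\leftrightarrow b_v)$. $\mathcal{C}$ is in general NNF if each $b_v$ is monotone as a function of the literals over $I$ and of the variables $\mathrm{in}(v)$ (i.e. negative literals in prime implicates of $b_v$ come only from input variables); then $\mathrm{ts}_r(\mathcal{C})=\{\{o\}\}\cup\bigcup_{v}\mathrm{prc}_0(v\to b_v)$. A CNF-representation of $f$ is a clause-set $F$ with $\mathrm{var}(f)\subseteq\mathrm{var}(F)$ such that for every total assignment $\varphi$ of $\mathrm{var}(f)$, $\varphi*F$ is satisfiable iff $f(\varphi)=1$. $F$ has sat-recognition via a map $r$ w.r.t. $V$ if $r(\varphi*F)=\top$ for every total assignment $\varphi$ of $V$ with $\varphi*F$ satisfiable, and usat-recognition via $r$ if $r(\varphi*F)=\{\bot\}$ for every total $\varphi$ of $V$ with $\varphi*F$ unsatisfiable. A UP-representation of $f$ is a CNF-representation with sat- and usat-recognition via $r_1$ w.r.t. $\mathrm{var}(f)$.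
   Formalization: var(f) is taken as the set of inputs essential for at least one gate b_v, not those essential for f itself; with the latter the claim fails, e.g. b_v = i, b_o = v ∨ ¬i, where f = 1 but unit propagation leaves the clauses of v ↔ i. *)

theory Defs
  imports Main
begin

section \<open>Clause-sets and partial assignments\<close>

datatype 'v literal = Pos (lit_var: 'v) | Neg (lit_var: 'v)

primrec complement :: "'v literal \<Rightarrow> 'v literal" where
  "complement (Pos v) = Neg v"
| "complement (Neg v) = Pos v"

type_synonym 'v clause = "'v literal set"
type_synonym 'v passign = "'v \<rightharpoonup> bool"

definition is_clause :: "'v clause \<Rightarrow> bool" where
  "is_clause C \<longleftrightarrow> finite C \<and> (\<forall>x\<in>C. complement x \<notin> C)"

definition is_clause_set :: "'v clause set \<Rightarrow> bool" where
  "is_clause_set F \<longleftrightarrow> finite F \<and> (\<forall>C\<in>F. is_clause C)"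

definition cls_vars :: "'v clause set \<Rightarrow> 'v set" where
  "cls_vars F = lit_var ` \<Union>F"

primrec lit_val :: "'v passign \<Rightarrow> 'v literal \<Rightarrow> bool option" where
  "lit_val \<phi> (Pos v) = \<phi> v"
| "lit_val \<phi> (Neg v) = map_option Not (\<phi> v)"

definition apply_passign :: "'v passign \<Rightarrow> 'v clause set \<Rightarrow> 'v clause set"  (infixr \<open>\<star>\<close> 75) where
  "\<phi> \<star> F = {{x \<in> C. lit_val \<phi> x \<noteq> Some False} | C. C \<in> F \<and> (\<forall>x\<in>C. lit_val \<phi> x \<noteq> Some True)}"

definition satisfiable :: "'v clause set \<Rightarrow> bool" where
  "satisfiable F \<longleftrightarrow> (\<exists>\<phi>. \<phi> \<star> F = {})"

primrec set_true :: "'v literal \<Rightarrow> 'v passign" where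
  "set_true (Pos v) = [v \<mapsto> True]"
| "set_true (Neg v) = [v \<mapsto> False]"


section \<open>Unit-clause propagation and pure literals\<close>

text \<open>
  The recursion terminates on every (finite) clause-set, where its result does not depend on
  the order in which the unit clauses are selected.
\<close>

partial_function (tailrec) r1 :: "'v clause set \<Rightarrow> 'v clause set" where
  "r1 F = (if {} \<in> F then {{}}
           else if \<exists>x. {x} \<in> F then r1 (set_true (SOME x. {x} \<in> F) \<star> F)
           else F)"

definition pure_literals :: "'v clause set \<Rightarrow> 'v literal set" where
  "pure_literals F = {x \<in> \<Union>F. complement x \<notin> \<Union>F}"

definition pure_assign :: "'v clause set \<Rightarrow> 'v passign" where
  "pure_assign F = (\<lambda>v. if Pos v \<in> pure_literals F then Some True
                        else if Neg v \<in> pure_literals F then Some False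
                        else None)"

partial_function (tailrec) pure_elim :: "'v clause set \<Rightarrow> 'v clause set" where
  "pure_elim F = (if pure_assign F \<star> F = F then F else pure_elim (pure_assign F \<star> F))"

definition r1pl :: "'v clause set \<Rightarrow> 'v clause set" where
  "r1pl F = pure_elim (r1 F)"


section \<open>Boolean functions and prime implicates\<close>

text \<open>
  A boolean function is given by a finite set of variables \<open>bvars\<close> together with a map on
  assignments of the whole variable type that depends only on the values on \<open>bvars\<close>.
\<close>

record 'v bool_fun =
  bvars :: "'v set"
  bval :: "('v \<Rightarrow> bool) \<Rightarrow> bool"

definition is_bool_fun :: "'v bool_fun \<Rightarrow> bool" where
  "is_bool_fun b \<longleftrightarrow> finite (bvars b) \<and>
     (\<forall>\<alpha> \<beta>. (\<forall>v\<in>bvars b. \<alpha> v = \<beta> v) \<longrightarrow> bval b \<alpha> = bval b \<beta>)"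

definition essential :: "'v bool_fun \<Rightarrow> 'v set" where
  "essential b = {v. \<exists>\<alpha>. bval b (\<alpha>(v := True)) \<noteq> bval b (\<alpha>(v := False))}"

primrec lit_true :: "('v \<Rightarrow> bool) \<Rightarrow> 'v literal \<Rightarrow> bool" where
  "lit_true \<alpha> (Pos v) = \<alpha> v"
| "lit_true \<alpha> (Neg v) = (\<not> \<alpha> v)"

definition implicate :: "'v bool_fun \<Rightarrow> 'v clause \<Rightarrow> bool" where
  "implicate b C \<longleftrightarrow> is_clause C \<and> (\<forall>\<alpha>. bval b \<alpha> \<longrightarrow> (\<exists>x\<in>C. lit_true \<alpha> x))"

definition prc0 :: "'v bool_fun \<Rightarrow> 'v clause set" where
  "prc0 b = {C. implicate b C \<and> (\<forall>D. D \<subset> C \<longrightarrow> \<not> implicate b D)}"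

definition bf_iff :: "'v \<Rightarrow> 'v bool_fun \<Rightarrow> 'v bool_fun" where
  "bf_iff v b = \<lparr>bvars = insert v (bvars b), bval = (\<lambda>\<alpha>. \<alpha> v \<longleftrightarrow> bval b \<alpha>)\<rparr>"

definition bf_imp :: "'v \<Rightarrow> 'v bool_fun \<Rightarrow> 'v bool_fun" where
  "bf_imp v b = \<lparr>bvars = insert v (bvars b), bval = (\<lambda>\<alpha>. \<alpha> v \<longrightarrow> bval b \<alpha>)\<rparr>"


section \<open>General circuits\<close>

record 'v circuit =
  nodes :: "'v set"
  arcs :: "('v \<times> 'v) set"
  inputs :: "'v set"
  gate :: "'v \<Rightarrow> 'v bool_fun"
  out :: 'v

definition in_nodes :: "'v circuit \<Rightarrow> 'v \<Rightarrow> 'v set" where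
  "in_nodes \<C> v = {u. (u, v) \<in> arcs \<C>}"

definition general_circuit :: "'v circuit \<Rightarrow> bool" where
  "general_circuit \<C> \<longleftrightarrow>
     finite (nodes \<C>) \<and> arcs \<C> \<subseteq> nodes \<C> \<times> nodes \<C> \<and> acyclic (arcs \<C>) \<and>
     finite (inputs \<C>) \<and> inputs \<C> \<inter> nodes \<C> = {} \<and> out \<C> \<in> nodes \<C> \<and>
     (\<forall>v\<in>nodes \<C>. is_bool_fun (gate \<C> v) \<and>
        in_nodes \<C> v \<subseteq> bvars (gate \<C> v) \<and>
        bvars (gate \<C> v) \<subseteq> in_nodes \<C> v \<union> inputs \<C>)"

text \<open>
  The value computed at a node under an assignment of the inputs, by recursion along the arcs;
  see \<open>node_val_unfold\<close> for the recursion equation.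
\<close>

definition node_val :: "'v circuit \<Rightarrow> ('v \<Rightarrow> bool) \<Rightarrow> 'v \<Rightarrow> bool" where
  "node_val \<C> \<alpha> = wfrec (arcs \<C>)
     (\<lambda>val v. bval (gate \<C> v) (\<lambda>u. if u \<in> nodes \<C> then val u else \<alpha> u))"

text \<open>
  The variables of the underlying function are the essential input variables of the circuit:
  the inputs on which at least one gate really depends. All inputs on which the
  output depends are among them (\<open>essential_underlying\<close>), but an input on which
  only gates depend, not the output, is included as well: it occurs in the Tseitin
  translations, and unit-clause propagation does not in general come to an end while it is
  unassigned. For example, with gates \<open>v = i\<close> and \<open>o = v \<or> \<not>i\<close>, where the output is constantly
  true, unit-clause propagation without a value for \<open>i\<close> leaves the clauses of \<open>v \<longleftrightarrow> i\<close>.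
\<close>

definition underlying :: "'v circuit \<Rightarrow> 'v bool_fun" where
  "underlying \<C> =
     \<lparr>bvars = {i \<in> inputs \<C>. \<exists>v\<in>nodes \<C>. i \<in> essential (gate \<C> v)},
      bval = (\<lambda>\<alpha>. node_val \<C> \<alpha> (out \<C>))\<rparr>"

text \<open>
  In general NNF every gate is a monotone function of the positive literals and of the
  negative literals over the inputs; the other negative literals are not available (their
  argument is constantly false).
\<close>

definition general_nnf :: "'v circuit \<Rightarrow> bool" where
  "general_nnf \<C> \<longleftrightarrow>
     (\<forall>v\<in>nodes \<C>. \<exists>g :: ('v literal \<Rightarrow> bool) \<Rightarrow> bool. mono g \<and>
        (\<forall>\<alpha>. bval (gate \<C> v) \<alpha> =
               g (\<lambda>x. case x of Pos u \<Rightarrow> \<alpha> u | Neg u \<Rightarrow> u \<in> inputs \<C> \<and> \<not> \<alpha> u)))"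

definition ts :: "'v circuit \<Rightarrow> 'v clause set" where
  "ts \<C> = {{Pos (out \<C>)}} \<union> (\<Union>v\<in>nodes \<C>. prc0 (bf_iff v (gate \<C> v)))"

definition ts_r :: "'v circuit \<Rightarrow> 'v clause set" where
  "ts_r \<C> = {{Pos (out \<C>)}} \<union> (\<Union>v\<in>nodes \<C>. prc0 (bf_imp v (gate \<C> v)))"


section \<open>Representations\<close>

definition cnf_representation :: "'v clause set \<Rightarrow> 'v bool_fun \<Rightarrow> bool" where
  "cnf_representation F f \<longleftrightarrow> is_clause_set F \<and> bvars f \<subseteq> cls_vars F \<and>
     (\<forall>\<phi>. dom \<phi> = bvars f \<longrightarrow> (satisfiable (\<phi> \<star> F) \<longleftrightarrow> bval f (\<lambda>v. \<phi> v = Some True)))"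

definition sat_recognition ::
  "('v clause set \<Rightarrow> 'v clause set) \<Rightarrow> 'v set \<Rightarrow> 'v clause set \<Rightarrow> bool" where
  "sat_recognition r V F \<longleftrightarrow> (\<forall>\<phi>. dom \<phi> = V \<and> satisfiable (\<phi> \<star> F) \<longrightarrow> r (\<phi> \<star> F) = {})"

definition usat_recognition ::
  "('v clause set \<Rightarrow> 'v clause set) \<Rightarrow> 'v set \<Rightarrow> 'v clause set \<Rightarrow> bool" where
  "usat_recognition r V F \<longleftrightarrow> (\<forall>\<phi>. dom \<phi> = V \<and> \<not> satisfiable (\<phi> \<star> F) \<longrightarrow> r (\<phi> \<star> F) = {{}})"

definition up_representation :: "'v clause set \<Rightarrow> 'v bool_fun \<Rightarrow> bool" where
  "up_representation F f \<longleftrightarrow> cnf_representation F f \<and>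
     sat_recognition r1 (bvars f) F \<and> usat_recognition r1 (bvars f) F"


section \<open>Basic facts about the underlying function\<close>

lemma wf_arcs:
  assumes "general_circuit \<C>"
  shows "wf (arcs \<C>)"
proof (rule finite_acyclic_wf)
  show "finite (arcs \<C>)"
    using assms finite_subset unfolding general_circuit_def by blast
  show "acyclic (arcs \<C>)"
    using assms unfolding general_circuit_def by blast
qed

lemma node_val_unfold:
  assumes \<C>: "general_circuit \<C>" and v: "v \<in> nodes \<C>"
  shows "node_val \<C> \<alpha> v =
    bval (gate \<C> v) (\<lambda>u. if u \<in> nodes \<C> then node_val \<C> \<alpha> u else \<alpha> u)"
proof -
  have b: "is_bool_fun (gate \<C> v)" and sub: "bvars (gate \<C> v) \<subseteq> in_nodes \<C> v \<union> inputs \<C>"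
    and disj: "inputs \<C> \<inter> nodes \<C> = {}"
    using \<C> v unfolding general_circuit_def by blast+
  have "node_val \<C> \<alpha> v = bval (gate \<C> v)
      (\<lambda>u. if u \<in> nodes \<C> then cut (node_val \<C> \<alpha>) (arcs \<C>) v u else \<alpha> u)"
    unfolding node_val_def by (subst wfrec[OF wf_arcs[OF \<C>]]) simp
  also have "\<dots> = bval (gate \<C> v) (\<lambda>u. if u \<in> nodes \<C> then node_val \<C> \<alpha> u else \<alpha> u)"
    (is "bval _ ?l = bval _ ?r")
  proof -
    have "\<forall>u\<in>bvars (gate \<C> v). ?l u = ?r u"
      using sub disj by (auto simp: cut_def in_nodes_def)
    moreover have "(\<forall>u\<in>bvars (gate \<C> v). ?l u = ?r u) \<longrightarrow> bval (gate \<C> v) ?l = bval (gate \<C> v) ?r"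
      using b unfolding is_bool_fun_def by (elim conjE) (erule allE, erule allE)
    ultimately show ?thesis by (rule rev_mp)
  qed
  finally show ?thesis .
qed

lemma essential_determines:
  assumes b: "is_bool_fun b" and eq: "\<And>v. v \<in> essential b \<Longrightarrow> \<alpha> v = \<beta> v"
  shows "bval b \<alpha> = bval b \<beta>"
proof -
  have step: "bval b (\<gamma>(v := x)) = bval b \<gamma>" if "v \<notin> essential b" for \<gamma> v x
  proof -
    have "bval b (\<gamma>(v := True)) = bval b (\<gamma>(v := False))"
      using that unfolding essential_def by blast
    then have "bval b (\<gamma>(v := x)) = bval b (\<gamma>(v := \<gamma> v))"
      by (cases x; cases "\<gamma> v") simp_all
    then show ?thesis by simp
  qed
  define mix where "mix S = (\<lambda>v. if v \<in> S then \<beta> v else \<alpha> v)" for S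
  have "bval b (mix S) = bval b \<alpha>" if "finite S" for S
    using that
  proof (induction S)
    case empty
    have "mix {} = \<alpha>" by (simp add: mix_def)
    then show ?case by simp
  next
    case (insert w S)
    have g: "mix (insert w S) = (mix S)(w := \<beta> w)" by (rule ext) (simp add: mix_def)
    show ?case
    proof (cases "w \<in> essential b")
      case True
      then have "(mix S)(w := \<beta> w) = mix S" using insert.hyps eq by (simp add: mix_def fun_eq_iff)
      then show ?thesis unfolding g using insert.IH by simp
    next
      case False
      then show ?thesis unfolding g insert.IH[symmetric] by (rule step)
    qed
  qed
  then have "bval b (mix (bvars b)) = bval b \<alpha>"
    using b unfolding is_bool_fun_def by blast
  moreover have "\<forall>v\<in>bvars b. mix (bvars b) v = \<beta> v" by (simp add: mix_def)
  then have "bval b (mix (bvars b)) = bval b \<beta>"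
    using b unfolding is_bool_fun_def by blast
  ultimately show ?thesis by simp
qed

lemma is_bool_fun_underlying:
  assumes \<C>: "general_circuit \<C>"
  shows "is_bool_fun (underlying \<C>)"
proof -
  let ?V = "bvars (underlying \<C>)"
  have "node_val \<C> \<alpha> v = node_val \<C> \<beta> v"
    if eq: "\<forall>u\<in>?V. \<alpha> u = \<beta> u" and "v \<in> nodes \<C>" for \<alpha> \<beta> v
    using \<open>v \<in> nodes \<C>\<close>
  proof (induction v rule: wf_induct_rule[OF wf_arcs[OF \<C>]])
    case (1 v)
    have b: "is_bool_fun (gate \<C> v)" and sub: "bvars (gate \<C> v) \<subseteq> in_nodes \<C> v \<union> inputs \<C>"
      and disj: "inputs \<C> \<inter> nodes \<C> = {}"
      using \<C> 1 unfolding general_circuit_def by blast+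
    have ess: "essential (gate \<C> v) \<subseteq> bvars (gate \<C> v)"
    proof
      fix u assume "u \<in> essential (gate \<C> v)"
      then obtain \<gamma> where \<gamma>: "bval (gate \<C> v) (\<gamma>(u := True)) \<noteq> bval (gate \<C> v) (\<gamma>(u := False))"
        unfolding essential_def by blast
      show "u \<in> bvars (gate \<C> v)"
      proof (rule ccontr)
        assume "u \<notin> bvars (gate \<C> v)"
        then have "\<forall>w\<in>bvars (gate \<C> v). (\<gamma>(u := True)) w = (\<gamma>(u := False)) w" by auto
        then show False using b \<gamma> unfolding is_bool_fun_def by blast
      qed
    qed
    have "(if u \<in> nodes \<C> then node_val \<C> \<alpha> u else \<alpha> u)
        = (if u \<in> nodes \<C> then node_val \<C> \<beta> u else \<beta> u)"
      if u: "u \<in> essential (gate \<C> v)" for u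
    proof (cases "u \<in> nodes \<C>")
      case True
      then have "(u, v) \<in> arcs \<C>" using u ess sub disj by (auto simp: in_nodes_def)
      then show ?thesis using 1 True by simp
    next
      case False
      then have "u \<in> inputs \<C>"
        using u ess sub \<C> by (auto simp: in_nodes_def general_circuit_def)
      then have "u \<in> ?V" using u 1 by (auto simp: underlying_def)
      then show ?thesis using False eq by simp
    qed
    from essential_determines[OF b this] show ?case
      using node_val_unfold[OF \<C> 1(2)] by simp
  qed
  moreover have "out \<C> \<in> nodes \<C>" "finite ?V"
    using \<C> by (auto simp: general_circuit_def underlying_def)
  ultimately show ?thesis
    unfolding is_bool_fun_def by (auto simp: underlying_def)
qed

lemma essential_underlying:
  assumes "general_circuit \<C>"
  shows "essential (underlying \<C>) \<subseteq> bvars (underlying \<C>)"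
proof
  fix u assume "u \<in> essential (underlying \<C>)"
  then obtain \<gamma> where \<gamma>: "bval (underlying \<C>) (\<gamma>(u := True)) \<noteq> bval (underlying \<C>) (\<gamma>(u := False))"
    unfolding essential_def by blast
  show "u \<in> bvars (underlying \<C>)"
  proof (rule ccontr)
    assume "u \<notin> bvars (underlying \<C>)"
    then have "\<forall>w\<in>bvars (underlying \<C>). (\<gamma>(u := True)) w = (\<gamma>(u := False)) w" by auto
    then show False
      using is_bool_fun_underlying[OF assms] \<gamma> unfolding is_bool_fun_def by blast
  qed
qed

end

theory Submission
  imports Defs
begin

text \<open>
  Unit-clause propagation stops either with a refutation or with a residue \<open>\<theta> \<star> F\<close> all of whose
  clauses have at least two literals. For \<open>ts\<close>, an induction along the arcs shows that in the second
  case \<open>\<theta>\<close> assigns every node: once the predecessors of \<open>v\<close> are assigned, every total extension of \<open>\<theta>\<close>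
  must satisfy \<open>v \<longleftrightarrow> b\<^sub>v\<close>, since a violated equivalence would leave a prime implicate with at most
  one literal; but both values of \<open>v\<close> cannot be correct. Hence the residue is empty. For \<open>ts_r\<close> of a
  circuit in general NNF, every clause of the residue consists of positive literals on predecessors
  of some node \<open>v\<close> and possibly \<open>\<not>v\<close>. Having at least two literals, it contains a positive one, so
  the residue is satisfied by setting all nodes to true; moreover, a node that occurs positively
  while none of its predecessors does is a pure literal, so pure literal elimination removes
  every clause.
\<close>

section \<open>Partial assignments\<close>

definition satisfies :: "('v \<Rightarrow> bool) \<Rightarrow> 'v clause set \<Rightarrow> bool" where
  "satisfies \<alpha> F \<longleftrightarrow> (\<forall>C\<in>F. \<exists>x\<in>C. lit_true \<alpha> x)"

lemma satisfies_insert: "satisfies \<alpha> (insert C F) \<longleftrightarrow> (\<exists>x\<in>C. lit_true \<alpha> x) \<and> satisfies \<alpha> F"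
  by (simp add: satisfies_def)

lemma satisfies_UN: "satisfies \<alpha> (\<Union>i\<in>I. F i) \<longleftrightarrow> (\<forall>i\<in>I. satisfies \<alpha> (F i))"
  by (auto simp: satisfies_def)

lemma lit_true_cong: "\<alpha> (lit_var x) = \<beta> (lit_var x) \<Longrightarrow> lit_true \<alpha> x = lit_true \<beta> x"
  by (cases x) auto

lemma satisfies_cong:
  assumes "\<And>v. v \<in> cls_vars F \<Longrightarrow> \<alpha> v = \<beta> v"
  shows "satisfies \<alpha> F \<longleftrightarrow> satisfies \<beta> F"
proof -
  have "lit_true \<alpha> x = lit_true \<beta> x" if "C \<in> F" "x \<in> C" for C x
    using that assms by (intro lit_true_cong) (auto simp: cls_vars_def)
  then show ?thesis by (simp add: satisfies_def)
qed

lemma cls_vars_insert: "cls_vars (insert C F) = lit_var ` C \<union> cls_vars F"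
  by (auto simp: cls_vars_def)

lemma cls_vars_UN: "cls_vars (\<Union>i\<in>I. F i) = (\<Union>i\<in>I. cls_vars (F i))"
  by (auto simp: cls_vars_def)

lemma is_clause_set_insert: "is_clause_set (insert C F) \<longleftrightarrow> is_clause C \<and> is_clause_set F"
  by (auto simp: is_clause_set_def)

lemma is_clause_set_UN:
  "finite I \<Longrightarrow> (\<And>i. i \<in> I \<Longrightarrow> is_clause_set (F i)) \<Longrightarrow> is_clause_set (\<Union>i\<in>I. F i)"
  by (auto simp: is_clause_set_def)

lemma finite_cls_vars: "is_clause_set F \<Longrightarrow> finite (cls_vars F)"
  by (auto simp: is_clause_set_def is_clause_def cls_vars_def)

lemma lit_val_eq_None_iff: "lit_val \<phi> x = None \<longleftrightarrow> lit_var x \<notin> dom \<phi>"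
  by (cases x) auto

lemma lit_val_map_add:
  "lit_val (\<psi> ++ \<phi>) x = (case lit_val \<phi> x of None \<Rightarrow> lit_val \<psi> x | Some b \<Rightarrow> Some b)"
  by (cases x) (auto simp: map_add_def split: option.splits)

lemma lit_val_total: "lit_val (Some \<circ> \<alpha>) x = Some (lit_true \<alpha> x)"
  by (cases x) auto

lemma lit_val_map_le_total:
  "\<phi> \<subseteq>\<^sub>m Some \<circ> \<alpha> \<Longrightarrow> lit_val \<phi> x = (if lit_var x \<in> dom \<phi> then Some (lit_true \<alpha> x) else None)"
  by (cases x) (auto simp: map_le_def)

lemma map_le_total_extension: "\<phi> \<subseteq>\<^sub>m Some \<circ> (\<lambda>v. \<phi> v = Some True)"
  by (auto simp: map_le_def)

lemma apply_passign_mono: "F \<subseteq> G \<Longrightarrow> \<phi> \<star> F \<subseteq> \<phi> \<star> G"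
  by (auto simp: apply_passign_def)

lemma finite_apply_passign: "finite F \<Longrightarrow> finite (\<phi> \<star> F)"
  by (simp add: apply_passign_def)

lemma apply_passign_Map_empty: "Map.empty \<star> F = F"
proof -
  have "lit_val Map.empty x = None" for x :: "'a literal" by (simp add: lit_val_eq_None_iff)
  then show ?thesis by (simp add: apply_passign_def)
qed

lemma apply_passign_map_add: "\<psi> \<star> \<phi> \<star> F = (\<psi> ++ \<phi>) \<star> F"
proof -
  let ?rest = "\<lambda>\<phi> C. {x \<in> C. lit_val \<phi> x \<noteq> Some False}"
  let ?unsat = "\<lambda>\<phi> C. \<forall>x\<in>C. lit_val \<phi> x \<noteq> Some True"
  have rest: "?rest (\<psi> ++ \<phi>) C = ?rest \<psi> (?rest \<phi> C)" if "?unsat \<phi> C" for C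
    using that by (auto simp: lit_val_map_add split: option.splits)
  have unsat: "?unsat (\<psi> ++ \<phi>) C \<longleftrightarrow> ?unsat \<phi> C \<and> ?unsat \<psi> (?rest \<phi> C)" for C
    by (auto simp: lit_val_map_add split: option.splits) (metis (full_types) option.exhaust)+
  have "\<psi> \<star> \<phi> \<star> F = {?rest \<psi> (?rest \<phi> C) | C. C \<in> F \<and> ?unsat \<phi> C \<and> ?unsat \<psi> (?rest \<phi> C)}"
    unfolding apply_passign_def by blast
  also have "\<dots> = {?rest (\<psi> ++ \<phi>) C | C. C \<in> F \<and> ?unsat (\<psi> ++ \<phi>) C}"
    unfolding unsat using rest by blast
  finally show ?thesis unfolding apply_passign_def .
qed

lemma apply_passign_subclause:
  assumes "D \<in> \<phi> \<star> F"
  obtains C where "C \<in> F" "D \<subseteq> C" "lit_var ` D \<inter> dom \<phi> = {}"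
proof -
  obtain C where C: "C \<in> F" "D = {x \<in> C. lit_val \<phi> x \<noteq> Some False}"
    "\<forall>x\<in>C. lit_val \<phi> x \<noteq> Some True"
    using assms unfolding apply_passign_def by blast
  have "lit_val \<phi> x = None" if "x \<in> D" for x
    using that C by (cases "lit_val \<phi> x") auto
  then have "lit_var ` D \<inter> dom \<phi> = {}" unfolding lit_val_eq_None_iff by blast
  with C(1,2) that show ?thesis by blast
qed

lemma cls_vars_apply_passign: "cls_vars (\<phi> \<star> F) \<subseteq> cls_vars F - dom \<phi>"
proof
  fix v assume "v \<in> cls_vars (\<phi> \<star> F)"
  then obtain D x where D: "D \<in> \<phi> \<star> F" and x: "x \<in> D" "v = lit_var x"
    by (auto simp: cls_vars_def)
  from D obtain C where "C \<in> F" "D \<subseteq> C" "lit_var ` D \<inter> dom \<phi> = {}"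
    by (rule apply_passign_subclause)
  with x show "v \<in> cls_vars F - dom \<phi>" by (auto simp: cls_vars_def)
qed

lemma apply_passign_total_eq_empty_iff: "(Some \<circ> \<alpha>) \<star> F = {} \<longleftrightarrow> satisfies \<alpha> F"
  by (auto simp: apply_passign_def satisfies_def lit_val_total)

lemma apply_passign_eq_empty_mono:
  assumes "\<phi> \<star> F = {}" "\<phi> \<subseteq>\<^sub>m \<psi>"
  shows "\<psi> \<star> F = {}"
proof -
  have "\<psi> \<star> F = \<psi> \<star> \<phi> \<star> F"
    using assms(2) by (simp add: apply_passign_map_add map_add_subsumed2)
  also have "\<dots> = {}" unfolding assms(1) by (simp add: apply_passign_def)
  finally show ?thesis .
qed

lemma satisfiable_apply_passign_iff:
  "satisfiable (\<phi> \<star> F) \<longleftrightarrow> (\<exists>\<alpha>. \<phi> \<subseteq>\<^sub>m Some \<circ> \<alpha> \<and> satisfies \<alpha> F)"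
proof
  assume "satisfiable (\<phi> \<star> F)"
  then obtain \<psi> where \<psi>: "(\<psi> ++ \<phi>) \<star> F = {}"
    unfolding satisfiable_def apply_passign_map_add ..
  define \<alpha> where "\<alpha> = (\<lambda>v. (\<psi> ++ \<phi>) v = Some True)"
  have "\<psi> ++ \<phi> \<subseteq>\<^sub>m Some \<circ> \<alpha>" unfolding \<alpha>_def by (rule map_le_total_extension)
  then have "\<phi> \<subseteq>\<^sub>m Some \<circ> \<alpha>" and "(Some \<circ> \<alpha>) \<star> F = {}"
    using map_le_trans[OF map_le_map_add] apply_passign_eq_empty_mono[OF \<psi>] by blast+
  then show "\<exists>\<alpha>. \<phi> \<subseteq>\<^sub>m Some \<circ> \<alpha> \<and> satisfies \<alpha> F"
    unfolding apply_passign_total_eq_empty_iff by blast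
next
  assume "\<exists>\<alpha>. \<phi> \<subseteq>\<^sub>m Some \<circ> \<alpha> \<and> satisfies \<alpha> F"
  then obtain \<alpha> where "\<phi> \<subseteq>\<^sub>m Some \<circ> \<alpha>" "satisfies \<alpha> F" by blast
  then have "(Some \<circ> \<alpha>) \<star> \<phi> \<star> F = {}"
    by (simp add: apply_passign_map_add map_add_subsumed2 apply_passign_total_eq_empty_iff)
  then show "satisfiable (\<phi> \<star> F)" unfolding satisfiable_def by blast
qed

lemma satisfiable_iff: "satisfiable F \<longleftrightarrow> (\<exists>\<alpha>. satisfies \<alpha> F)"
  using satisfiable_apply_passign_iff[of Map.empty F] by (simp add: apply_passign_Map_empty)

lemma satisfiable_apply_passignD: "satisfiable (\<phi> \<star> F) \<Longrightarrow> satisfiable F"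
  by (metis satisfiable_apply_passign_iff satisfiable_iff)

section \<open>Unit-clause propagation\<close>

definition r1_irreducible :: "'v clause set \<Rightarrow> bool" where
  "r1_irreducible F \<longleftrightarrow> (\<forall>C\<in>F. \<forall>x. \<not> C \<subseteq> {x})"

lemma r1_irreducible_subset: "r1_irreducible G \<Longrightarrow> F \<subseteq> G \<Longrightarrow> r1_irreducible F"
  by (auto simp: r1_irreducible_def)

lemma r1_irreducible_iff: "r1_irreducible F \<longleftrightarrow> {} \<notin> F \<and> (\<forall>x. {x} \<notin> F)"
  by (auto simp: r1_irreducible_def subset_singleton_iff)

lemma satisfiable_set_true_unit:
  assumes "{x} \<in> F" "satisfiable F"
  shows "satisfiable (set_true x \<star> F)"
proof -
  obtain \<alpha> where \<alpha>: "satisfies \<alpha> F" using assms(2) unfolding satisfiable_iff ..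
  then have "lit_true \<alpha> x" using assms(1) by (auto simp: satisfies_def)
  then have "set_true x \<subseteq>\<^sub>m Some \<circ> \<alpha>" by (cases x) (auto simp: map_le_def)
  with \<alpha> show ?thesis unfolding satisfiable_apply_passign_iff by blast
qed

lemma cls_vars_set_true_unit:
  assumes "{x} \<in> F"
  shows "cls_vars (set_true x \<star> F) \<subset> cls_vars F"
proof -
  have "lit_var x \<in> cls_vars F" using assms unfolding cls_vars_def by blast
  moreover have "lit_var x \<in> dom (set_true x)" by (cases x) auto
  ultimately show ?thesis using cls_vars_apply_passign[of "set_true x" F] by blast
qed

lemma r1_refutes_or_irreducible:
  assumes "finite (cls_vars F)"
  shows "r1 F = {{}} \<and> \<not> satisfiable F \<or> (\<exists>\<psi>. r1 F = \<psi> \<star> F \<and> r1_irreducible (\<psi> \<star> F))"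
  using assms
proof (induction "cls_vars F" arbitrary: F rule: finite_psubset_induct)
  case (psubset F)
  consider (empty) "{} \<in> F" | (unit) "{} \<notin> F" "\<exists>x. {x} \<in> F" | (irreducible) "r1_irreducible F"
    unfolding r1_irreducible_iff by blast
  then show ?case
  proof cases
    case empty
    then have "\<not> satisfiable F" by (auto simp: satisfiable_iff satisfies_def)
    then show ?thesis using empty by (simp add: r1.simps[of F])
  next
    case unit
    define x where "x = (SOME x. {x} \<in> F)"
    have x: "{x} \<in> F" unfolding x_def using unit(2) by (rule someI_ex)
    have step: "r1 F = r1 (set_true x \<star> F)" using unit by (simp add: r1.simps[of F] x_def)
    from psubset.hyps(2)[OF cls_vars_set_true_unit[OF x]] show ?thesis
    proof (elim disjE exE conjE)
      assume "r1 (set_true x \<star> F) = {{}}" "\<not> satisfiable (set_true x \<star> F)"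
      then show ?thesis using step satisfiable_set_true_unit[OF x] by auto
    next
      fix \<psi> assume "r1 (set_true x \<star> F) = \<psi> \<star> set_true x \<star> F"
        "r1_irreducible (\<psi> \<star> set_true x \<star> F)"
      then show ?thesis unfolding step apply_passign_map_add by blast
    qed
  next
    case irreducible
    then have "r1 F = Map.empty \<star> F"
      by (simp add: r1.simps[of F] r1_irreducible_iff apply_passign_Map_empty)
    then show ?thesis using irreducible by (metis apply_passign_Map_empty)
  qed
qed

lemma r1_apply_passign_cases:
  assumes "is_clause_set F"
  obtains (refutation) "r1 (\<phi> \<star> F) = {{}}" "\<not> satisfiable (\<phi> \<star> F)"
  | (residue) \<theta> where "r1 (\<phi> \<star> F) = \<theta> \<star> F" "r1_irreducible (\<theta> \<star> F)" "\<phi> \<subseteq>\<^sub>m \<theta>"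
      "satisfiable (\<theta> \<star> F) \<Longrightarrow> satisfiable (\<phi> \<star> F)"
proof -
  have "finite (cls_vars (\<phi> \<star> F))"
    using cls_vars_apply_passign finite_cls_vars[OF assms] by (metis finite_Diff finite_subset)
  from r1_refutes_or_irreducible[OF this] show ?thesis
  proof (elim disjE exE conjE)
    fix \<psi> assume \<psi>: "r1 (\<phi> \<star> F) = \<psi> \<star> \<phi> \<star> F" "r1_irreducible (\<psi> \<star> \<phi> \<star> F)"
    show ?thesis
      using \<psi> map_le_map_add satisfiable_apply_passignD[of \<psi> "\<phi> \<star> F"]
      by (intro residue[of "\<psi> ++ \<phi>"]) (simp_all add: apply_passign_map_add)
  qed (rule refutation)
qed

lemma usat_recognition_r1:
  assumes F: "is_clause_set F"
    and sat: "\<And>\<theta>. V \<subseteq> dom \<theta> \<Longrightarrow> r1_irreducible (\<theta> \<star> F) \<Longrightarrow> satisfiable (\<theta> \<star> F)"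
  shows "usat_recognition r1 V F"
  unfolding usat_recognition_def
proof (intro allI impI, elim conjE)
  fix \<phi> :: "'a passign" assume \<phi>: "dom \<phi> = V" "\<not> satisfiable (\<phi> \<star> F)"
  from F show "r1 (\<phi> \<star> F) = {{}}"
  proof (cases rule: r1_apply_passign_cases[where \<phi> = \<phi>])
    case (residue \<theta>)
    then have "V \<subseteq> dom \<theta>" using \<phi>(1) map_le_implies_dom_le by blast
    then show ?thesis using sat residue(2,4) \<phi>(2) by blast
  qed
qed

lemma sat_recognition_after_r1:
  assumes F: "is_clause_set F"
    and r: "\<And>\<theta>. V \<subseteq> dom \<theta> \<Longrightarrow> r1_irreducible (\<theta> \<star> F) \<Longrightarrow> r (\<theta> \<star> F) = {}"
  shows "sat_recognition (\<lambda>G. r (r1 G)) V F"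
  unfolding sat_recognition_def
proof (intro allI impI, elim conjE)
  fix \<phi> :: "'a passign" assume \<phi>: "dom \<phi> = V" "satisfiable (\<phi> \<star> F)"
  from F show "r (r1 (\<phi> \<star> F)) = {}"
  proof (cases rule: r1_apply_passign_cases[where \<phi> = \<phi>])
    case refutation
    then show ?thesis using \<phi>(2) by blast
  next
    case (residue \<theta>)
    then have "V \<subseteq> dom \<theta>" using \<phi>(1) map_le_implies_dom_le by blast
    then show ?thesis using r residue(1,2) by simp
  qed
qed

section \<open>Pure literal elimination\<close>

lemma apply_pure_assign: "pure_assign F \<star> F = {C \<in> F. C \<inter> pure_literals F = {}}"
proof -
  have true: "lit_val (pure_assign F) x = Some True \<longleftrightarrow> x \<in> pure_literals F" for x
    by (cases x) (auto simp: pure_assign_def pure_literals_def)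
  have not_false: "lit_val (pure_assign F) x \<noteq> Some False" if "C \<in> F" "x \<in> C" for x C
    using that by (cases x) (auto simp: pure_assign_def pure_literals_def)
  have "{x \<in> C. lit_val (pure_assign F) x \<noteq> Some False} = C" if "C \<in> F" for C
    using not_false[OF that] by blast
  then show ?thesis unfolding apply_passign_def true by fastforce
qed

lemma pure_elim_eq_empty:
  assumes "finite F" "\<And>G. G \<subseteq> F \<Longrightarrow> G \<noteq> {} \<Longrightarrow> pure_literals G \<noteq> {}"
  shows "pure_elim F = {}"
  using assms
proof (induction F rule: finite_psubset_induct)
  case (psubset F)
  show ?case
  proof (cases "F = {}")
    case True
    then show ?thesis by (simp add: pure_elim.simps[of "{}"] apply_pure_assign)
  next
    case False
    then obtain x where "x \<in> pure_literals F" using psubset.prems by blast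
    moreover from this obtain C where "C \<in> F" "x \<in> C" by (auto simp: pure_literals_def)
    ultimately have smaller: "pure_assign F \<star> F \<subset> F" unfolding apply_pure_assign by blast
    then have "pure_elim (pure_assign F \<star> F) = {}"
      using psubset.IH psubset.prems by (meson psubset_imp_subset subset_trans)
    moreover have "pure_assign F \<star> F \<noteq> F" using smaller by blast
    ultimately show ?thesis by (simp add: pure_elim.simps[of F])
  qed
qed

definition dual_horn_literals :: "('v \<times> 'v) set \<Rightarrow> 'v \<Rightarrow> 'v literal set" where
  "dual_horn_literals R v = insert (Neg v) {Pos u | u. (u, v) \<in> R}"

definition dag_dual_horn :: "('v \<times> 'v) set \<Rightarrow> 'v clause set \<Rightarrow> bool" where
  "dag_dual_horn R F \<longleftrightarrow> (\<forall>C\<in>F. \<exists>v. C \<subseteq> dual_horn_literals R v)"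

lemma dag_dual_horn_subset: "dag_dual_horn R G \<Longrightarrow> F \<subseteq> G \<Longrightarrow> dag_dual_horn R F"
  by (auto simp: dag_dual_horn_def)

lemma dag_dual_horn_clauseE:
  assumes "dag_dual_horn R F" "r1_irreducible F" "C \<in> F"
  obtains u v where "Pos u \<in> C" "(u, v) \<in> R" "\<forall>w. Neg w \<in> C \<longrightarrow> w = v"
proof -
  obtain v where v: "C \<subseteq> dual_horn_literals R v"
    using assms(1,3) unfolding dag_dual_horn_def by blast
  have "\<not> C \<subseteq> {Neg v}" using assms(2,3) unfolding r1_irreducible_def by blast
  then obtain u where "Pos u \<in> C" "(u, v) \<in> R" using v unfolding dual_horn_literals_def by blast
  moreover have "\<forall>w. Neg w \<in> C \<longrightarrow> w = v" using v unfolding dual_horn_literals_def by blast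
  ultimately show ?thesis by (rule that)
qed

lemma satisfiable_dag_dual_horn:
  assumes "dag_dual_horn R F" "r1_irreducible F"
  shows "satisfiable F"
proof -
  have "\<exists>x\<in>C. lit_true (\<lambda>_. True) x" if C: "C \<in> F" for C
  proof -
    obtain u where "Pos u \<in> C" using dag_dual_horn_clauseE[OF assms C] by blast
    then show ?thesis by force
  qed
  then show ?thesis unfolding satisfiable_iff satisfies_def by blast
qed

lemma pure_literals_dag_dual_horn:
  assumes "wf R" "dag_dual_horn R F" "r1_irreducible F" "F \<noteq> {}"
  shows "pure_literals F \<noteq> {}"
proof -
  obtain C where C: "C \<in> F" using assms(4) by blast
  obtain u where "Pos u \<in> C" by (rule dag_dual_horn_clauseE[OF assms(2,3) C])
  with C have "u \<in> {u. Pos u \<in> \<Union>F}" by blast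
  from wfE_min[OF assms(1) this] obtain w
    where w: "Pos w \<in> \<Union>F" and min: "\<And>u. (u, w) \<in> R \<Longrightarrow> Pos u \<notin> \<Union>F"
    by (metis mem_Collect_eq)
  have "Neg w \<notin> \<Union>F"
  proof
    assume "Neg w \<in> \<Union>F"
    then obtain D where D: "D \<in> F" "Neg w \<in> D" by blast
    obtain u v where "Pos u \<in> D" "(u, v) \<in> R" "\<forall>w. Neg w \<in> D \<longrightarrow> w = v"
      by (rule dag_dual_horn_clauseE[OF assms(2,3) D(1)])
    then show False using min D by blast
  qed
  then have "Pos w \<in> pure_literals F" using w by (simp add: pure_literals_def)
  then show ?thesis by blast
qed

lemma pure_elim_dag_dual_horn:
  assumes "finite F" "wf R" "dag_dual_horn R F" "r1_irreducible F"
  shows "pure_elim F = {}"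
  using assms(1)
proof (rule pure_elim_eq_empty)
  fix G assume "G \<subseteq> F" "G \<noteq> {}"
  then show "pure_literals G \<noteq> {}"
    using pure_literals_dag_dual_horn[OF assms(2)] dag_dual_horn_subset[OF assms(3)]
      r1_irreducible_subset[OF assms(4)] by blast
qed

section \<open>Prime implicates\<close>

lemma is_bool_fun_cong:
  assumes "is_bool_fun b" "\<And>v. v \<in> bvars b \<Longrightarrow> \<alpha> v = \<beta> v"
  shows "bval b \<alpha> = bval b \<beta>"
  using assms(1)[unfolded is_bool_fun_def, THEN conjunct2, rule_format, of \<alpha> \<beta>] assms(2) by blast

lemma essential_subset_bvars:
  assumes "is_bool_fun b"
  shows "essential b \<subseteq> bvars b"
proof (rule ccontr)
  assume "\<not> essential b \<subseteq> bvars b"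
  then obtain v \<alpha> where v: "v \<notin> bvars b" "bval b (\<alpha>(v := True)) \<noteq> bval b (\<alpha>(v := False))"
    unfolding essential_def by blast
  moreover have "bval b (\<alpha>(v := True)) = bval b (\<alpha>(v := False))"
    using v(1) by (intro is_bool_fun_cong[OF assms]) auto
  ultimately show False by blast
qed

lemma finite_essential: "is_bool_fun b \<Longrightarrow> finite (essential b)"
  using finite_subset[OF essential_subset_bvars] by (auto simp: is_bool_fun_def)

lemma bval_upd_inessential: "is_bool_fun b \<Longrightarrow> v \<notin> essential b \<Longrightarrow> bval b (\<alpha>(v := x)) = bval b \<alpha>"
  by (rule essential_determines) auto

lemma implicate_contains_prime:
  assumes "implicate b C"
  obtains D where "D \<in> prc0 b" "D \<subseteq> C"
proof -
  let ?S = "{D. D \<subseteq> C \<and> implicate b D}"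
  have "finite ?S" "?S \<noteq> {}" using assms by (auto simp: implicate_def is_clause_def)
  then obtain D where D: "D \<in> ?S" "\<not> (\<exists>E\<in>?S. E \<subset> D)" using ex_min_if_finite by meson
  then have "D \<in> prc0 b" unfolding prc0_def by blast
  then show ?thesis using that D(1) by blast
qed

definition false_literal :: "('v \<Rightarrow> bool) \<Rightarrow> 'v \<Rightarrow> 'v literal" where
  "false_literal \<alpha> v = (if \<alpha> v then Neg v else Pos v)"

lemma lit_true_false_literal: "lit_true \<beta> (false_literal \<alpha> v) \<longleftrightarrow> \<beta> v \<noteq> \<alpha> v"
  by (simp add: false_literal_def)

lemma is_clause_false_literals: "finite V \<Longrightarrow> is_clause (false_literal \<alpha> ` V)"
  by (auto simp: is_clause_def false_literal_def)

lemma implicate_false_literals: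
  assumes b: "is_bool_fun b" and "\<not> bval b \<alpha>"
  shows "implicate b (false_literal \<alpha> ` essential b)"
proof -
  have "\<exists>x\<in>false_literal \<alpha> ` essential b. lit_true \<beta> x" if \<beta>: "bval b \<beta>" for \<beta>
  proof -
    obtain v where "v \<in> essential b" "\<beta> v \<noteq> \<alpha> v"
      using essential_determines[OF b, of \<beta> \<alpha>] \<beta> assms(2) by blast
    then show ?thesis by (simp add: lit_true_false_literal bexI[of _ v])
  qed
  then show ?thesis
    using is_clause_false_literals[OF finite_essential[OF b]] by (simp add: implicate_def)
qed

lemma falsified_prime_implicate:
  assumes "is_bool_fun b" "\<not> bval b \<alpha>"
  obtains C where "C \<in> prc0 b" "C \<subseteq> false_literal \<alpha> ` essential b"
  using implicate_contains_prime[OF implicate_false_literals[OF assms]] by blast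

lemma satisfies_prc0:
  assumes "is_bool_fun b"
  shows "satisfies \<alpha> (prc0 b) \<longleftrightarrow> bval b \<alpha>"
proof
  show "satisfies \<alpha> (prc0 b)" if "bval b \<alpha>"
    using that by (simp add: satisfies_def prc0_def implicate_def)
next
  assume sat: "satisfies \<alpha> (prc0 b)"
  show "bval b \<alpha>"
  proof (rule ccontr)
    assume "\<not> bval b \<alpha>"
    then obtain C where "C \<in> prc0 b" "C \<subseteq> false_literal \<alpha> ` essential b"
      using falsified_prime_implicate[OF assms] by blast
    moreover from this obtain x where "x \<in> C" "lit_true \<alpha> x"
      using sat by (auto simp: satisfies_def)
    ultimately show False by (auto simp: lit_true_false_literal)
  qed
qed

lemma bval_if_r1_irreducible_prc0:
  assumes b: "is_bool_fun b" and irreducible: "r1_irreducible (\<theta> \<star> prc0 b)"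
    and \<theta>: "\<theta> \<subseteq>\<^sub>m Some \<circ> \<alpha>" "essential b \<subseteq> insert v (dom \<theta>)"
  shows "bval b \<alpha>"
proof (rule ccontr)
  assume "\<not> bval b \<alpha>"
  then obtain C where C: "C \<in> prc0 b" "C \<subseteq> false_literal \<alpha> ` essential b"
    using falsified_prime_implicate[OF b] by blast
  then have val: "lit_val \<theta> x = (if lit_var x \<in> dom \<theta> then Some False else None)" if "x \<in> C" for x
    using that lit_val_map_le_total[OF \<theta>(1), of x] by (auto simp: lit_true_false_literal)
  let ?D = "{x \<in> C. lit_val \<theta> x \<noteq> Some False}"
  have "x = false_literal \<alpha> v" if x: "x \<in> C" "lit_val \<theta> x \<noteq> Some False" for x
  proof -
    obtain u where u: "x = false_literal \<alpha> u" "u \<in> essential b" using C(2) x(1) by blast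
    moreover have "lit_var x = u" unfolding u(1) by (simp add: false_literal_def)
    ultimately show ?thesis using \<theta>(2) val[OF x(1)] x(2) by (auto split: if_splits)
  qed
  then have "?D \<subseteq> {false_literal \<alpha> v}" by blast
  moreover have "\<forall>x\<in>C. lit_val \<theta> x \<noteq> Some True" using val by simp
  then have "?D \<in> \<theta> \<star> prc0 b"
    using C(1) unfolding apply_passign_def by blast
  ultimately show False using irreducible unfolding r1_irreducible_def by blast
qed

lemma prime_implicate_literal:
  assumes "C \<in> prc0 b" "x \<in> C"
  obtains \<alpha> where "bval b \<alpha>" "lit_true \<alpha> x"
    "\<not> bval b (\<alpha>(lit_var x := \<not> \<alpha> (lit_var x)))"
proof -
  have C: "implicate b C" and "\<not> implicate b (C - {x})"
    using assms by (auto simp: prc0_def)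
  moreover have "is_clause (C - {x})" using C by (auto simp: implicate_def is_clause_def)
  ultimately obtain \<alpha> where \<alpha>: "bval b \<alpha>" "\<forall>y\<in>C - {x}. \<not> lit_true \<alpha> y"
    unfolding implicate_def by blast
  let ?\<beta> = "\<alpha>(lit_var x := \<not> \<alpha> (lit_var x))"
  have x: "lit_true \<alpha> x" using C \<alpha> unfolding implicate_def by blast
  have complement: "complement x \<notin> C" using C assms(2) by (simp add: implicate_def is_clause_def)
  have "\<not> lit_true ?\<beta> y" if y: "y \<in> C" for y
  proof (cases "y = x")
    case True
    then show ?thesis using x by (cases x) auto
  next
    case False
    have "lit_var y \<noteq> lit_var x" using False y complement by (cases x; cases y) auto
    then have "lit_true ?\<beta> y = lit_true \<alpha> y" by (intro lit_true_cong) simp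
    then show ?thesis using \<alpha>(2) y False by blast
  qed
  then have "\<not> bval b ?\<beta>" using C unfolding implicate_def by blast
  then show ?thesis using that \<alpha>(1) x by blast
qed

lemma prime_implicate_essential:
  assumes "C \<in> prc0 b" "x \<in> C"
  shows "lit_var x \<in> essential b"
proof -
  obtain \<alpha> where \<alpha>: "bval b \<alpha>" "\<not> bval b (\<alpha>(lit_var x := \<not> \<alpha> (lit_var x)))"
    using assms by (rule prime_implicate_literal)
  have "bval b (\<alpha>(lit_var x := True)) \<noteq> bval b (\<alpha>(lit_var x := False))"
    using \<alpha> fun_upd_triv[of \<alpha> "lit_var x"] by (cases "\<alpha> (lit_var x)") simp_all
  then show ?thesis unfolding essential_def by blast
qed

lemma Neg_notin_prime_implicate:
  assumes "\<And>\<alpha>. bval b \<alpha> \<Longrightarrow> bval b (\<alpha>(v := True))" "C \<in> prc0 b"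
  shows "Neg v \<notin> C"
proof
  assume "Neg v \<in> C"
  with assms(2) obtain \<alpha> where "bval b \<alpha>" "lit_true \<alpha> (Neg v)" "\<not> bval b (\<alpha>(v := \<not> \<alpha> v))"
    using prime_implicate_literal by (metis literal.sel(2))
  then show False using assms(1)[of \<alpha>] by simp
qed

lemma Pos_notin_prime_implicate:
  assumes "\<And>\<alpha>. bval b \<alpha> \<Longrightarrow> bval b (\<alpha>(v := False))" "C \<in> prc0 b"
  shows "Pos v \<notin> C"
proof
  assume "Pos v \<in> C"
  with assms(2) obtain \<alpha> where "bval b \<alpha>" "lit_true \<alpha> (Pos v)" "\<not> bval b (\<alpha>(v := \<not> \<alpha> v))"
    using prime_implicate_literal by (metis literal.sel(1))
  then show False using assms(1)[of \<alpha>] by simp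
qed

lemma cls_vars_prc0:
  assumes b: "is_bool_fun b"
  shows "cls_vars (prc0 b) = essential b"
proof
  show "cls_vars (prc0 b) \<subseteq> essential b"
    using prime_implicate_essential unfolding cls_vars_def by blast
  have "v \<notin> essential b" if "v \<notin> cls_vars (prc0 b)" for v
  proof -
    have "satisfies (\<alpha>(v := True)) (prc0 b) = satisfies (\<alpha>(v := False)) (prc0 b)" for \<alpha>
      using that by (intro satisfies_cong) auto
    then show ?thesis by (simp add: essential_def satisfies_prc0[OF b])
  qed
  then show "essential b \<subseteq> cls_vars (prc0 b)" by blast
qed

lemma is_clause_set_prc0:
  assumes "is_bool_fun b"
  shows "is_clause_set (prc0 b)"
proof -
  have "x \<in> Pos ` essential b \<union> Neg ` essential b" if "lit_var x \<in> essential b" for x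
    using that by (cases x) auto
  then have "prc0 b \<subseteq> Pow (Pos ` essential b \<union> Neg ` essential b)"
    using prime_implicate_essential by blast
  then have "finite (prc0 b)" using finite_essential[OF assms] finite_subset by blast
  then show ?thesis by (simp add: is_clause_set_def prc0_def implicate_def)
qed

lemma is_bool_fun_connective:
  assumes b: "is_bool_fun b"
  shows "is_bool_fun \<lparr>bvars = insert v (bvars b), bval = (\<lambda>\<alpha>. f (\<alpha> v) (bval b \<alpha>))\<rparr>"
  unfolding is_bool_fun_def bool_fun.simps
proof (intro conjI allI impI)
  show "finite (insert v (bvars b))" using b by (simp add: is_bool_fun_def)
  fix \<alpha> \<beta> :: "'a \<Rightarrow> bool" assume "\<forall>u\<in>insert v (bvars b). \<alpha> u = \<beta> u"
  then show "f (\<alpha> v) (bval b \<alpha>) = f (\<beta> v) (bval b \<beta>)"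
    using is_bool_fun_cong[OF b, of \<alpha> \<beta>] by simp
qed

lemma is_bool_fun_bf_iff: "is_bool_fun b \<Longrightarrow> is_bool_fun (bf_iff v b)"
  using is_bool_fun_connective[of b v "(\<longleftrightarrow>)"] by (simp add: bf_iff_def)

lemma is_bool_fun_bf_imp: "is_bool_fun b \<Longrightarrow> is_bool_fun (bf_imp v b)"
  using is_bool_fun_connective[of b v "(\<longrightarrow>)"] by (simp add: bf_imp_def)

lemma essential_bf_iff:
  assumes "v \<notin> essential b"
  shows "essential (bf_iff v b) = insert v (essential b)"
proof (rule set_eqI)
  fix u
  show "u \<in> essential (bf_iff v b) \<longleftrightarrow> u \<in> insert v (essential b)"
  proof (cases "u = v")
    case True
    then show ?thesis using assms by (simp add: essential_def bf_iff_def)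
  next
    case False
    then have depends: "bval (bf_iff v b) (\<alpha>(u := True)) = bval (bf_iff v b) (\<alpha>(u := False)) \<longleftrightarrow>
        bval b (\<alpha>(u := True)) = bval b (\<alpha>(u := False))" for \<alpha>
      by (auto simp: bf_iff_def)
    have "u \<in> essential (bf_iff v b) \<longleftrightarrow> u \<in> essential b"
      by (simp only: essential_def mem_Collect_eq depends)
    then show ?thesis using False by simp
  qed
qed

lemma essential_bf_imp: "essential (bf_imp v b) \<subseteq> insert v (essential b)"
  unfolding essential_def bf_imp_def by auto

section \<open>Tseitin translations\<close>

definition gate_consistent :: "'v circuit \<Rightarrow> ('v \<Rightarrow> bool) \<Rightarrow> bool" where
  "gate_consistent \<C> \<alpha> \<longleftrightarrow> (\<forall>v\<in>nodes \<C>. \<alpha> v = bval (gate \<C> v) \<alpha>)"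

definition circuit_val :: "'v circuit \<Rightarrow> ('v \<Rightarrow> bool) \<Rightarrow> 'v \<Rightarrow> bool" where
  "circuit_val \<C> \<alpha> = (\<lambda>u. if u \<in> nodes \<C> then node_val \<C> \<alpha> u else \<alpha> u)"

context
  fixes \<C> :: "'v circuit"
  assumes \<C>: "general_circuit \<C>"
begin

lemma finite_nodes: "finite (nodes \<C>)"
  using \<C> by (simp add: general_circuit_def)

lemma out_in_nodes: "out \<C> \<in> nodes \<C>"
  using \<C> by (simp add: general_circuit_def)

lemma is_bool_fun_gate: "v \<in> nodes \<C> \<Longrightarrow> is_bool_fun (gate \<C> v)"
  using \<C> by (simp add: general_circuit_def)

lemma in_nodes_subset_nodes: "in_nodes \<C> v \<subseteq> nodes \<C>"
  using \<C> by (auto simp: general_circuit_def in_nodes_def)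

lemma bvars_underlying_disjoint_nodes: "bvars (underlying \<C>) \<inter> nodes \<C> = {}"
  using \<C> by (auto simp: general_circuit_def underlying_def)

lemma essential_gate_subset:
  assumes v: "v \<in> nodes \<C>"
  shows "essential (gate \<C> v) \<subseteq> in_nodes \<C> v \<union> bvars (underlying \<C>)"
proof -
  have "essential (gate \<C> v) \<subseteq> in_nodes \<C> v \<union> inputs \<C>"
    using essential_subset_bvars[OF is_bool_fun_gate[OF v]] \<C> v
    unfolding general_circuit_def by blast
  then show ?thesis using v by (auto simp: underlying_def)
qed

lemma node_notin_essential_gate:
  assumes v: "v \<in> nodes \<C>"
  shows "v \<notin> essential (gate \<C> v)"
proof -
  have "v \<notin> in_nodes \<C> v" using wf_not_refl[OF wf_arcs[OF \<C>]] by (simp add: in_nodes_def)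
  then show ?thesis using essential_gate_subset[OF v] bvars_underlying_disjoint_nodes v by blast
qed

lemma is_clause_set_ts: "is_clause_set (ts \<C>)"
  by (simp add: ts_def is_clause_set_insert is_clause_def is_clause_set_UN finite_nodes
      is_clause_set_prc0 is_bool_fun_bf_iff is_bool_fun_gate)

lemma is_clause_set_ts_r: "is_clause_set (ts_r \<C>)"
  by (simp add: ts_r_def is_clause_set_insert is_clause_def is_clause_set_UN finite_nodes
      is_clause_set_prc0 is_bool_fun_bf_imp is_bool_fun_gate)

lemma cls_vars_ts: "cls_vars (ts \<C>) = nodes \<C> \<union> bvars (underlying \<C>)"
proof -
  have "cls_vars (ts \<C>) = insert (out \<C>) (\<Union>v\<in>nodes \<C>. insert v (essential (gate \<C> v)))"
    by (simp add: ts_def cls_vars_insert cls_vars_UN cls_vars_prc0 essential_bf_iff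
        is_bool_fun_bf_iff is_bool_fun_gate node_notin_essential_gate)
  also have "\<dots> = nodes \<C> \<union> bvars (underlying \<C>)"
    using out_in_nodes essential_gate_subset in_nodes_subset_nodes by (fastforce simp: underlying_def)
  finally show ?thesis .
qed

lemma satisfies_ts: "satisfies \<alpha> (ts \<C>) \<longleftrightarrow> \<alpha> (out \<C>) \<and> gate_consistent \<C> \<alpha>"
proof -
  have "satisfies \<alpha> (prc0 (bf_iff v (gate \<C> v))) \<longleftrightarrow> \<alpha> v = bval (gate \<C> v) \<alpha>"
    if "v \<in> nodes \<C>" for v
    using satisfies_prc0[OF is_bool_fun_bf_iff[OF is_bool_fun_gate[OF that]]]
    by (simp add: bf_iff_def)
  then show ?thesis by (simp add: ts_def gate_consistent_def satisfies_insert satisfies_UN)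
qed

lemma node_val_eq_gate:
  "v \<in> nodes \<C> \<Longrightarrow> node_val \<C> \<alpha> v = bval (gate \<C> v) (circuit_val \<C> \<alpha>)"
  unfolding circuit_val_def by (rule node_val_unfold[OF \<C>])

lemma node_val_gate_consistent:
  assumes \<alpha>: "gate_consistent \<C> \<alpha>" and "v \<in> nodes \<C>"
  shows "node_val \<C> \<alpha> v = \<alpha> v"
  using wf_arcs[OF \<C>] assms(2)
proof (induction v rule: wf_induct_rule)
  case (less v)
  have "circuit_val \<C> \<alpha> u = \<alpha> u" if "u \<in> essential (gate \<C> v)" for u
    using that essential_gate_subset[OF less.prems] less.IH bvars_underlying_disjoint_nodes
    by (auto simp: circuit_val_def in_nodes_def)
  then have "bval (gate \<C> v) (circuit_val \<C> \<alpha>) = bval (gate \<C> v) \<alpha>"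
    by (rule essential_determines[OF is_bool_fun_gate[OF less.prems]])
  then show ?case
    using \<alpha> less.prems node_val_eq_gate[OF less.prems] by (simp add: gate_consistent_def)
qed

lemma gate_consistent_circuit_val: "gate_consistent \<C> (circuit_val \<C> \<alpha>)"
  unfolding gate_consistent_def
proof
  fix v assume v: "v \<in> nodes \<C>"
  then have "circuit_val \<C> \<alpha> v = node_val \<C> \<alpha> v" by (simp add: circuit_val_def)
  also have "\<dots> = bval (gate \<C> v) (circuit_val \<C> \<alpha>)" using v by (rule node_val_eq_gate)
  finally show "circuit_val \<C> \<alpha> v = bval (gate \<C> v) (circuit_val \<C> \<alpha>)" .
qed

lemma satisfiable_ts_iff:
  assumes \<phi>: "dom \<phi> = bvars (underlying \<C>)"
  shows "satisfiable (\<phi> \<star> ts \<C>) \<longleftrightarrow> bval (underlying \<C>) (\<lambda>v. \<phi> v = Some True)"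
    (is "_ \<longleftrightarrow> bval _ ?\<phi>")
proof
  assume "satisfiable (\<phi> \<star> ts \<C>)"
  then obtain \<alpha> where ext: "\<phi> \<subseteq>\<^sub>m Some \<circ> \<alpha>" and \<alpha>: "\<alpha> (out \<C>)" "gate_consistent \<C> \<alpha>"
    unfolding satisfiable_apply_passign_iff satisfies_ts by blast
  have "bval (underlying \<C>) \<alpha>"
    using node_val_gate_consistent[OF \<alpha>(2) out_in_nodes] \<alpha>(1) by (simp add: underlying_def)
  moreover have "\<alpha> v = ?\<phi> v" if "v \<in> bvars (underlying \<C>)" for v
    using ext \<phi> that by (auto simp: map_le_def)
  ultimately show "bval (underlying \<C>) ?\<phi>"
    using is_bool_fun_cong[OF is_bool_fun_underlying[OF \<C>], of \<alpha> ?\<phi>] by blast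
next
  assume "bval (underlying \<C>) ?\<phi>"
  then have "circuit_val \<C> ?\<phi> (out \<C>)"
    using out_in_nodes by (simp add: circuit_val_def underlying_def)
  then have "satisfies (circuit_val \<C> ?\<phi>) (ts \<C>)"
    using gate_consistent_circuit_val by (simp add: satisfies_ts)
  moreover have "\<phi> \<subseteq>\<^sub>m Some \<circ> circuit_val \<C> ?\<phi>"
    using map_le_total_extension[of \<phi>] \<phi> bvars_underlying_disjoint_nodes
    by (auto simp: map_le_def circuit_val_def)
  ultimately show "satisfiable (\<phi> \<star> ts \<C>)" unfolding satisfiable_apply_passign_iff by blast
qed

lemma nodes_assigned_if_r1_irreducible_ts:
  assumes \<theta>: "bvars (underlying \<C>) \<subseteq> dom \<theta>" and irreducible: "r1_irreducible (\<theta> \<star> ts \<C>)"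
    and "v \<in> nodes \<C>"
  shows "v \<in> dom \<theta>"
  using wf_arcs[OF \<C>] assms(3)
proof (induction v rule: wf_induct_rule)
  case (less v)
  note gate = is_bool_fun_gate[OF less.prems] and v = node_notin_essential_gate[OF less.prems]
  let ?b = "bf_iff v (gate \<C> v)" and ?\<alpha> = "\<lambda>u. \<theta> u = Some True"
  have "prc0 ?b \<subseteq> ts \<C>" using less.prems by (auto simp: ts_def)
  then have prc0_irreducible: "r1_irreducible (\<theta> \<star> prc0 ?b)"
    by (intro r1_irreducible_subset[OF irreducible] apply_passign_mono)
  have "in_nodes \<C> v \<subseteq> dom \<theta>" using less.IH in_nodes_subset_nodes by (auto simp: in_nodes_def)
  then have ess: "essential ?b \<subseteq> insert v (dom \<theta>)"
    using essential_gate_subset[OF less.prems] \<theta> unfolding essential_bf_iff[OF v] by blast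
  show ?case
  proof (rule ccontr)
    assume "v \<notin> dom \<theta>"
    then have "\<theta> \<subseteq>\<^sub>m Some \<circ> ?\<alpha>(v := x)" for x by (auto simp: map_le_def)
    then have correct: "bval ?b (?\<alpha>(v := x))" for x
      by (rule bval_if_r1_irreducible_prc0[OF is_bool_fun_bf_iff[OF gate] prc0_irreducible _ ess])
    have "x \<longleftrightarrow> bval (gate \<C> v) ?\<alpha>" for x
      using correct[of x] by (simp add: bf_iff_def bval_upd_inessential[OF gate v])
    from this[of True] this[of False] show False by simp
  qed
qed

lemma ts_residue_empty:
  assumes "bvars (underlying \<C>) \<subseteq> dom \<theta>" "r1_irreducible (\<theta> \<star> ts \<C>)"
  shows "\<theta> \<star> ts \<C> = {}"
proof -
  have "cls_vars (\<theta> \<star> ts \<C>) = {}"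
    using cls_vars_apply_passign[of \<theta> "ts \<C>"] cls_vars_ts assms(1)
      nodes_assigned_if_r1_irreducible_ts[OF assms] by blast
  then have "D = {}" if "D \<in> \<theta> \<star> ts \<C>" for D using that unfolding cls_vars_def by blast
  then show ?thesis using assms(2) unfolding r1_irreducible_iff by blast
qed

theorem up_representation_ts: "up_representation (ts \<C>) (underlying \<C>)"
proof -
  let ?V = "bvars (underlying \<C>)"
  have "cnf_representation (ts \<C>) (underlying \<C>)"
    by (simp add: cnf_representation_def is_clause_set_ts cls_vars_ts satisfiable_ts_iff)
  moreover have "satisfiable (\<theta> \<star> ts \<C>)" if "?V \<subseteq> dom \<theta>" "r1_irreducible (\<theta> \<star> ts \<C>)" for \<theta>
    by (simp add: ts_residue_empty[OF that] satisfiable_iff satisfies_def)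
  then have "usat_recognition r1 ?V (ts \<C>)" by (rule usat_recognition_r1[OF is_clause_set_ts])
  moreover have "sat_recognition r1 ?V (ts \<C>)"
    using is_clause_set_ts ts_residue_empty by (rule sat_recognition_after_r1[where r = "\<lambda>G. G"])
  ultimately show ?thesis by (simp add: up_representation_def)
qed

lemma mono_gate:
  assumes "general_nnf \<C>" "v \<in> nodes \<C>" "u \<in> nodes \<C>" "bval (gate \<C> v) \<alpha>"
  shows "bval (gate \<C> v) (\<alpha>(u := True))"
proof -
  let ?lits = "\<lambda>\<alpha> x. case x of Pos u \<Rightarrow> \<alpha> u | Neg u \<Rightarrow> u \<in> inputs \<C> \<and> \<not> \<alpha> u"
  obtain g :: "('v literal \<Rightarrow> bool) \<Rightarrow> bool"
    where g: "mono g" "\<And>\<alpha>. bval (gate \<C> v) \<alpha> = g (?lits \<alpha>)"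
    using assms(1,2) unfolding general_nnf_def by blast
  have "u \<notin> inputs \<C>" using \<C> assms(3) unfolding general_circuit_def by blast
  then have "?lits \<alpha> \<le> ?lits (\<alpha>(u := True))" by (auto simp: le_fun_def split: literal.splits)
  from monoD[OF g(1) this] show ?thesis using assms(4) unfolding g(2) by simp
qed

lemma prc0_bf_imp_gate_literal:
  assumes nnf: "general_nnf \<C>" and v: "v \<in> nodes \<C>"
    and C: "C \<in> prc0 (bf_imp v (gate \<C> v))" and x: "x \<in> C" "lit_var x \<notin> bvars (underlying \<C>)"
  shows "x \<in> dual_horn_literals (arcs \<C>) v"
proof -
  have "lit_var x \<in> insert v (essential (gate \<C> v))"
    using prime_implicate_essential[OF C x(1)] essential_bf_imp by (rule set_rev_mp)
  then have var: "lit_var x = v \<or> lit_var x \<in> in_nodes \<C> v"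
    using essential_gate_subset[OF v] x(2) by blast
  have pos: "Pos v \<notin> C" by (rule Pos_notin_prime_implicate[OF _ C]) (simp add: bf_imp_def)
  have neg: "Neg u \<notin> C" if u: "u \<in> nodes \<C>" "u \<noteq> v" for u
  proof (rule Neg_notin_prime_implicate[OF _ C])
    fix \<alpha> assume "bval (bf_imp v (gate \<C> v)) \<alpha>"
    then show "bval (bf_imp v (gate \<C> v)) (\<alpha>(u := True))"
      using mono_gate[OF nnf v u(1), of \<alpha>] u(2) by (simp add: bf_imp_def)
  qed
  show ?thesis
  proof (cases x)
    case (Pos u)
    then have "u \<in> in_nodes \<C> v" using var pos x(1) by auto
    then show ?thesis using Pos by (simp add: in_nodes_def dual_horn_literals_def)
  next
    case (Neg u)
    then have "u = v" using var neg[of u] x(1) in_nodes_subset_nodes[of v] by auto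
    then show ?thesis using Neg by (simp add: dual_horn_literals_def)
  qed
qed

lemma ts_r_residue_dag_dual_horn:
  assumes nnf: "general_nnf \<C>" and \<theta>: "bvars (underlying \<C>) \<subseteq> dom \<theta>"
    and irreducible: "r1_irreducible (\<theta> \<star> ts_r \<C>)"
  shows "dag_dual_horn (arcs \<C>) (\<theta> \<star> ts_r \<C>)"
  unfolding dag_dual_horn_def
proof
  fix D assume D: "D \<in> \<theta> \<star> ts_r \<C>"
  then obtain C where C: "C \<in> ts_r \<C>" "D \<subseteq> C" "lit_var ` D \<inter> dom \<theta> = {}"
    by (rule apply_passign_subclause)
  then have "C \<noteq> {Pos (out \<C>)}" using irreducible D unfolding r1_irreducible_def by blast
  then obtain v where v: "v \<in> nodes \<C>" "C \<in> prc0 (bf_imp v (gate \<C> v))"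
    using C(1) by (auto simp: ts_r_def)
  have "x \<in> dual_horn_literals (arcs \<C>) v" if "x \<in> D" for x
    using C(2,3) \<theta> that by (intro prc0_bf_imp_gate_literal[OF nnf v]) blast+
  then show "\<exists>v. D \<subseteq> dual_horn_literals (arcs \<C>) v" by blast
qed

lemma usat_recognition_ts_r:
  assumes "general_nnf \<C>"
  shows "usat_recognition r1 (bvars (underlying \<C>)) (ts_r \<C>)"
  using is_clause_set_ts_r
proof (rule usat_recognition_r1)
  fix \<theta> assume \<theta>: "bvars (underlying \<C>) \<subseteq> dom \<theta>" "r1_irreducible (\<theta> \<star> ts_r \<C>)"
  show "satisfiable (\<theta> \<star> ts_r \<C>)"
    using ts_r_residue_dag_dual_horn[OF assms \<theta>] \<theta>(2) by (rule satisfiable_dag_dual_horn)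
qed

lemma sat_recognition_ts_r:
  assumes "general_nnf \<C>"
  shows "sat_recognition r1pl (bvars (underlying \<C>)) (ts_r \<C>)"
  unfolding r1pl_def using is_clause_set_ts_r
proof (rule sat_recognition_after_r1)
  fix \<theta> assume \<theta>: "bvars (underlying \<C>) \<subseteq> dom \<theta>" "r1_irreducible (\<theta> \<star> ts_r \<C>)"
  have "finite (\<theta> \<star> ts_r \<C>)"
    using is_clause_set_ts_r by (simp add: is_clause_set_def finite_apply_passign)
  then show "pure_elim (\<theta> \<star> ts_r \<C>) = {}"
    using wf_arcs[OF \<C>] ts_r_residue_dag_dual_horn[OF assms \<theta>] \<theta>(2)
    by (rule pure_elim_dag_dual_horn)
qed

end

theorem theorem5p13:
  fixes \<C> :: "'v circuit" and f :: "'v bool_fun"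
  assumes "general_circuit \<C>"
    and "f = underlying \<C>"
  shows "up_representation (ts \<C>) f \<and>
    (general_nnf \<C> \<longrightarrow>
       usat_recognition r1 (bvars f) (ts_r \<C>) \<and>
       sat_recognition r1pl (bvars f) (ts_r \<C>))"
  unfolding assms(2)
proof (intro conjI impI)
  show "up_representation (ts \<C>) (underlying \<C>)"
    using assms(1) by (rule up_representation_ts)
  assume "general_nnf \<C>"
  with assms(1) show "usat_recognition r1 (bvars (underlying \<C>)) (ts_r \<C>)"
    and "sat_recognition r1pl (bvars (underlying \<C>)) (ts_r \<C>)"
    by (rule usat_recognition_ts_r, rule sat_recognition_ts_r)
qed

end
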